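(* Let $\alpha(y)\neq 0$ on $(a,b)$ and suppose that $\Delta_n\neq 0$ for all $n\ge 0$, where $\Delta_n$ is the $(n+1)\times(n+1)$ determinant $$\Delta_n=\begin{vmatrix} 1 & \mathcal{L}_{\omega}[y] & \cdots & \mathcal{L}_{\omega}[y^{n}]\\ \mathcal{L}_{\alpha\omega}[1] & \mathcal{L}_{\alpha\omega}[y] & \cdots & \mathcal{L}_{\alpha\omega}[y^{n}]\\ \vdots & \vdots & \ddots & \vdots\\ \mathcal{L}_{\alpha\omega}[\alpha^{n-1}] & \mathcal{L}_{\alpha\omega}[y\alpha^{n-1}] & \cdots & \mathcal{L}_{\alpha\omega}[y^{n}\alpha^{n-1}] \end{vmatrix}$$ (the first row has entries $\mathcal{L}_\omega[y^j]$, $0\le j\le n$, and the row after it indexed by $i=0,\dots,n-1$ has entries $\mathcal{L}_{\alpha\omega}[y^j\alpha^i]$, $0\le j\le n$). If the sequence $(P_n)_{n\ge 0}$ is defined by $$P_n(x)=\frac{1}{\Delta_n}\begin{vmatrix} 1 & x & \cdots & x^{n}\\ \mathcal{L}_{\alpha\omega}[1] & \mathcal{L}_{\alpha\omega}[y] & \cdots & \mathcal{L}_{\alpha\omega}[y^{n}]\\ \vdots & \vdots & \ddots & \vdots\\ \mathcal{L}_{\alpha\omega}[\alpha^{n-1}] & \mathcal{L}_{\alpha\omega}[y\alpha^{n-1}] & \cdots & \mathcal{L}_{\alpha\omega}[y^{n}\alpha^{n-1}] \end{vmatrix},$$ then $$\int_a^b P_n(y)\,P_n[\alpha(y)+x]\,\omega(y)\,dy=P_n(x)$$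 for all $n$ (as an identity in $x$).
   Context: $(a,b)$ is an interval (possibly unbounded) of the real line. $\omega(y)$ is a non-negative integrable function on $(a,b)$ with $\int_a^b\omega(y)\,dy=1$. $\alpha(y)$ is an integrable function on $(a,b)$. For a weight function $w$ on $(a,b)$, $\mathcal{L}_w$ denotes the linear functional $\mathcal{L}_w[f]=\int_a^b f(y)w(y)\,dy$; thus $\mathcal{L}_{\alpha\omega}[f]=\int_a^b f(y)\alpha(y)\omega(y)\,dy$, and inside the functional $y$ denotes the integration variable and $\alpha=\alpha(y)$. All integrals appearing as entries of the determinants are assumed to converge (absolutely). $P_n[\alpha(y)+x]$ denotes the polynomial $P_n$ evaluated at $\alpha(y)+x$. For $n=0$ both determinants consist of the single entry $1$. *)

theory Defs
  imports "HOL-Analysis.Interval_Integral" "Jordan_Normal_Form.Determinant"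
begin

text \<open>
  The interval is \<open>einterval a b\<close> with \<open>a b :: ereal\<close>, so it is open and may be unbounded.
  Integrals are taken with respect to \<open>lebesgue\<close> (the completed measure), so that the functions
  need only be Lebesgue measurable. HOL-Analysis and Jordan-Normal-Form both provide \<open>mat\<close> and
  \<open>det\<close>; the names are qualified below to select those of Jordan-Normal-Form.
\<close>

definition weight_functional ::
  "ereal \<Rightarrow> ereal \<Rightarrow> (real \<Rightarrow> real) \<Rightarrow> (real \<Rightarrow> real) \<Rightarrow> real"
where
  "weight_functional a b w f = (LINT y:einterval a b|lebesgue. f y * w y)"

text \<open>
  Both determinants have the same rows below the first one: row \<open>Suc i\<close> has the entries
  \<open>\<L>\<^bsub>\<alpha>\<omega>\<^esub>[y\<^sup>j \<alpha>\<^sup>i]\<close>. The parameter \<open>r\<close> is the first row.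
\<close>

definition bordered_moment_mat ::
  "ereal \<Rightarrow> ereal \<Rightarrow> (real \<Rightarrow> real) \<Rightarrow> (real \<Rightarrow> real) \<Rightarrow> (nat \<Rightarrow> real) \<Rightarrow> nat \<Rightarrow> real Matrix.mat"
where
  "bordered_moment_mat a b \<omega> \<alpha> r n = Matrix.mat (Suc n) (Suc n) (\<lambda>(k, j).
     case k of
       0 \<Rightarrow> r j
     | Suc i \<Rightarrow> weight_functional a b (\<lambda>y. \<alpha> y * \<omega> y) (\<lambda>y. y ^ j * \<alpha> y ^ i))"

definition Delta ::
  "ereal \<Rightarrow> ereal \<Rightarrow> (real \<Rightarrow> real) \<Rightarrow> (real \<Rightarrow> real) \<Rightarrow> nat \<Rightarrow> real"
where
  "Delta a b \<omega> \<alpha> n = Determinant.det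
     (bordered_moment_mat a b \<omega> \<alpha> (\<lambda>j. weight_functional a b \<omega> (\<lambda>y. y ^ j)) n)"

definition Pn ::
  "ereal \<Rightarrow> ereal \<Rightarrow> (real \<Rightarrow> real) \<Rightarrow> (real \<Rightarrow> real) \<Rightarrow> nat \<Rightarrow> real \<Rightarrow> real"
where
  "Pn a b \<omega> \<alpha> n x = 1 / Delta a b \<omega> \<alpha> n *
     Determinant.det (bordered_moment_mat a b \<omega> \<alpha> (\<lambda>j. x ^ j) n)"

end

(* Expanding along the first row, P_n(x) = sum_j c_j x^j, where the same coefficients give
   L_omega[P_n] = 1 and, by equality of two rows, L_(alpha omega)[alpha^i P_n] = 0 for i < n.
   Taylor expansion gives P_n(alpha + x) = P_n(x) + alpha Q(alpha) with Q of degree less than n, and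
   the second term integrates to 0 against P_n omega. *)
theory Submission
  imports Defs
begin

text \<open>Laplace expansion along row 0: the cofactors there do not see that row, so one family
  \<open>C\<close> serves every \<open>r\<close>. Different choices of \<open>r\<close> then yield
  all the properties of the polynomial.\<close>

lemma det_bordered_moment_mat_linear:
  obtains C where "\<And>r. Determinant.det (bordered_moment_mat a b \<omega> \<alpha> r n) = (\<Sum>j\<le>n. C j * r j)"
proof -
  \<comment> \<open>The zero row is an arbitrary placeholder, since \<open>mat_delete\<close>
    removes row 0.\<close>
  define C where "C j = cofactor (bordered_moment_mat a b \<omega> \<alpha> (\<lambda>_. 0) n) 0 j" for j
  have "Determinant.det (bordered_moment_mat a b \<omega> \<alpha> r n) = (\<Sum>j\<le>n. C j * r j)" for r
  proof -
    let ?A = "bordered_moment_mat a b \<omega> \<alpha> r n"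
    have A: "?A \<in> carrier_mat (Suc n) (Suc n)"
      by (simp add: bordered_moment_mat_def)
    have "mat_delete ?A 0 j = mat_delete (bordered_moment_mat a b \<omega> \<alpha> (\<lambda>_. 0) n) 0 j" for j
      by (rule eq_matI) (auto simp: mat_delete_def bordered_moment_mat_def)
    then have "cofactor ?A 0 j = C j" for j
      by (simp add: C_def cofactor_def)
    moreover have "?A $$ (0, j) = r j" if "j \<le> n" for j
      using that by (simp add: bordered_moment_mat_def)
    ultimately show ?thesis
      using laplace_expansion_row[OF A, of 0]
      by (simp add: lessThan_Suc_atMost mult.commute)
  qed
  then show ?thesis by (rule that)
qed

text \<open>Row 0 repeats row \<open>Suc i\<close>, which is present because
  \<open>i < n\<close>.\<close>

lemma det_bordered_moment_mat_eq_0: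
  assumes "i < n"
  shows "Determinant.det (bordered_moment_mat a b \<omega> \<alpha>
    (\<lambda>j. weight_functional a b (\<lambda>y. \<alpha> y * \<omega> y) (\<lambda>y. y ^ j * \<alpha> y ^ i)) n) = 0"
  by (rule det_identical_rows[of _ "Suc n" 0 "Suc i"])
    (use assms in \<open>auto simp: bordered_moment_mat_def\<close>)

text \<open>The same normalized cofactors are paired with three first rows: the powers of
  \<open>x\<close>, the \<omega>-moments, whose determinant is \<open>Delta\<close> itself, and a
  copy of a lower row. The last two give normalization and orthogonality.\<close>

lemma Pn_expansion:
  assumes "Delta a b \<omega> \<alpha> n \<noteq> 0"
  obtains c where "\<And>x. Pn a b \<omega> \<alpha> n x = (\<Sum>j\<le>n. c j * x ^ j)"
    and "(\<Sum>j\<le>n. c j * weight_functional a b \<omega> (\<lambda>y. y ^ j)) = 1"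
    and "\<And>i. i < n \<Longrightarrow>
      (\<Sum>j\<le>n. c j * weight_functional a b (\<lambda>y. \<alpha> y * \<omega> y) (\<lambda>y. y ^ j * \<alpha> y ^ i)) = 0"
proof -
  obtain C where
    C: "\<And>r. Determinant.det (bordered_moment_mat a b \<omega> \<alpha> r n) = (\<Sum>j\<le>n. C j * r j)"
    using det_bordered_moment_mat_linear[of a b \<omega> \<alpha> n] by blast
  define c where "c j = C j / Delta a b \<omega> \<alpha> n" for j
  have c: "(\<Sum>j\<le>n. c j * r j) =
      Determinant.det (bordered_moment_mat a b \<omega> \<alpha> r n) / Delta a b \<omega> \<alpha> n" for r
    by (simp add: C c_def sum_divide_distrib)
  show ?thesis
  proof (rule that[of c])
    show "Pn a b \<omega> \<alpha> n x = (\<Sum>j\<le>n. c j * x ^ j)" for x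
      by (simp add: c Pn_def)
    show "(\<Sum>j\<le>n. c j * weight_functional a b \<omega> (\<lambda>y. y ^ j)) = 1"
      unfolding c using assms by (simp add: Delta_def)
    show "(\<Sum>j\<le>n. c j * weight_functional a b (\<lambda>y. \<alpha> y * \<omega> y) (\<lambda>y. y ^ j * \<alpha> y ^ i)) = 0"
      if "i < n" for i
      unfolding c using that by (simp add: det_bordered_moment_mat_eq_0)
  qed
qed

text \<open>Writing the non-constant part with \<open>u ^ Suc i\<close> prepares for
  \<open>u\<close> = \<alpha>(y): one factor joins \<omega> to form the weight \<alpha>\<omega>, and
  the remaining exponent \<open>i < n\<close> lies in the range of orthogonality.\<close>

lemma polynomial_shift:
  fixes c :: "nat \<Rightarrow> 'a::comm_ring_1"
  obtains d where "\<And>u. (\<Sum>j\<le>n. c j * (u + x) ^ j) =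
    (\<Sum>j\<le>n. c j * x ^ j) + (\<Sum>i<n. d i * u ^ Suc i)"
proof -
  \<comment> \<open>These are the Taylor coefficients at \<open>x\<close>, free of division.
    Truncation of \<open>j - m\<close> is harmless because the binomial coefficient vanishes for
    \<open>m > j\<close>.\<close>
  define e where "e m = (\<Sum>j\<le>n. c j * of_nat (j choose m) * x ^ (j - m))" for m
  have "(\<Sum>j\<le>n. c j * (u + x) ^ j) = (\<Sum>j\<le>n. c j * x ^ j) + (\<Sum>i<n. e (Suc i) * u ^ Suc i)" for u
  proof -
    \<comment> \<open>Padding with zero terms up to \<open>n\<close> makes the range of
      \<open>m\<close> independent of \<open>j\<close>, so the two sums can be swapped.\<close>
    have "(u + x) ^ j = (\<Sum>m\<le>n. of_nat (j choose m) * u ^ m * x ^ (j - m))" if "j \<le> n" for j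
      unfolding binomial_ring by (rule sum.mono_neutral_left) (use that in \<open>auto simp: binomial_eq_0\<close>)
    then have "(\<Sum>j\<le>n. c j * (u + x) ^ j) =
        (\<Sum>j\<le>n. \<Sum>m\<le>n. c j * of_nat (j choose m) * x ^ (j - m) * u ^ m)"
      by (simp add: sum_distrib_left mult_ac)
    also have "\<dots> = (\<Sum>m\<le>n. e m * u ^ m)"
      by (subst sum.swap) (simp add: e_def sum_distrib_right)
    also have "\<dots> = e 0 + (\<Sum>i<n. e (Suc i) * u ^ Suc i)"
      by (simp add: sum.atMost_shift)
    finally show ?thesis by (simp add: e_def)
  qed
  then show ?thesis by (rule that)
qed

text \<open>Integrability and value travel together through sums and scalar multiples in this
  form.\<close>

lemma has_bochner_integral_set_iff:
  fixes f :: "'a \<Rightarrow> 'b::{banach, second_countable_topology}"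
  shows "has_bochner_integral M (\<lambda>y. indicator S y *\<^sub>R f y) v \<longleftrightarrow>
    set_integrable M S f \<and> (LINT y:S|M. f y) = v"
  by (simp add: has_bochner_integral_iff set_integrable_def set_lebesgue_integral_def)

theorem theorem4:
  fixes a b :: ereal and \<omega> \<alpha> :: "real \<Rightarrow> real"
  assumes "a < b"
    and "\<And>y. y \<in> einterval a b \<Longrightarrow> 0 \<le> \<omega> y"
    and "set_integrable lebesgue (einterval a b) \<omega>"
    and "(LINT y:einterval a b|lebesgue. \<omega> y) = 1"
    and "set_integrable lebesgue (einterval a b) \<alpha>"
    and "\<And>j. set_integrable lebesgue (einterval a b) (\<lambda>y. y ^ j * \<omega> y)"
    and "\<And>i j. set_integrable lebesgue (einterval a b) (\<lambda>y. (y ^ j * \<alpha> y ^ i) * (\<alpha> y * \<omega> y))"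
    and "\<And>y. y \<in> einterval a b \<Longrightarrow> \<alpha> y \<noteq> 0"
    and "\<And>n. Delta a b \<omega> \<alpha> n \<noteq> 0"
  shows "\<forall>n x.
    set_integrable lebesgue (einterval a b)
      (\<lambda>y. Pn a b \<omega> \<alpha> n y * Pn a b \<omega> \<alpha> n (\<alpha> y + x) * \<omega> y) \<and>
    (LINT y:einterval a b|lebesgue. Pn a b \<omega> \<alpha> n y * Pn a b \<omega> \<alpha> n (\<alpha> y + x) * \<omega> y)
      = Pn a b \<omega> \<alpha> n x"
proof (intro allI)
  fix n x
  let ?S = "einterval a b"
  obtain c where P: "\<And>x. Pn a b \<omega> \<alpha> n x = (\<Sum>j\<le>n. c j * x ^ j)"
    and c1: "(\<Sum>j\<le>n. c j * weight_functional a b \<omega> (\<lambda>y. y ^ j)) = 1"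
    and c0: "\<And>i. i < n \<Longrightarrow>
      (\<Sum>j\<le>n. c j * weight_functional a b (\<lambda>y. \<alpha> y * \<omega> y) (\<lambda>y. y ^ j * \<alpha> y ^ i)) = 0"
    using Pn_expansion[OF assms(9)] by blast
  obtain d where d: "\<And>u. Pn a b \<omega> \<alpha> n (u + x) = Pn a b \<omega> \<alpha> n x + (\<Sum>i<n. d i * u ^ Suc i)"
    using polynomial_shift[where n = n and c = c and x = x] unfolding P by blast
  \<comment> \<open>Keeping \<open>*\<^sub>R\<close> unsimplified lets
    \<open>has_bochner_integral_set_iff\<close> match.\<close>
  have "has_bochner_integral lebesgue (\<lambda>y. \<Sum>j\<le>n. c j * (indicator ?S y *\<^sub>R (y ^ j * \<omega> y)))
      (\<Sum>j\<le>n. c j * weight_functional a b \<omega> (\<lambda>y. y ^ j))"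
    by (intro has_bochner_integral_sum has_bochner_integral_mult_right)
      (use assms(6) in \<open>simp add: has_bochner_integral_set_iff weight_functional_def del: real_scaleR_def\<close>)
  then have I1: "has_bochner_integral lebesgue (\<lambda>y. \<Sum>j\<le>n. c j * (indicator ?S y *\<^sub>R (y ^ j * \<omega> y))) 1"
    by (simp only: c1)
  have I0: "has_bochner_integral lebesgue
      (\<lambda>y. \<Sum>j\<le>n. c j * (indicator ?S y *\<^sub>R (y ^ j * \<alpha> y ^ i * (\<alpha> y * \<omega> y)))) 0"
    if "i < n" for i
  proof -
    have "has_bochner_integral lebesgue
        (\<lambda>y. \<Sum>j\<le>n. c j * (indicator ?S y *\<^sub>R (y ^ j * \<alpha> y ^ i * (\<alpha> y * \<omega> y))))
        (\<Sum>j\<le>n. c j * weight_functional a b (\<lambda>y. \<alpha> y * \<omega> y) (\<lambda>y. y ^ j * \<alpha> y ^ i))"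
      by (intro has_bochner_integral_sum has_bochner_integral_mult_right)
        (use assms(7) in \<open>simp add: has_bochner_integral_set_iff weight_functional_def del: real_scaleR_def\<close>)
    then show ?thesis by (simp only: c0[OF that])
  qed
  have "has_bochner_integral lebesgue
      (\<lambda>y. Pn a b \<omega> \<alpha> n x * (\<Sum>j\<le>n. c j * (indicator ?S y *\<^sub>R (y ^ j * \<omega> y))) +
        (\<Sum>i<n. d i * (\<Sum>j\<le>n. c j * (indicator ?S y *\<^sub>R (y ^ j * \<alpha> y ^ i * (\<alpha> y * \<omega> y))))))
      (Pn a b \<omega> \<alpha> n x * 1 + (\<Sum>i<n. d i * 0))"
    by (intro has_bochner_integral_add has_bochner_integral_sum has_bochner_integral_mult_right I1 I0) auto
  \<comment> \<open>Pointwise form of the shift at \<open>u\<close> = \<alpha>(y), multiplied by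
    P_n(y) \<omega>(y); off the interval both sides are 0.\<close>
  moreover have "Pn a b \<omega> \<alpha> n x * (\<Sum>j\<le>n. c j * (indicator ?S y *\<^sub>R (y ^ j * \<omega> y))) +
        (\<Sum>i<n. d i * (\<Sum>j\<le>n. c j * (indicator ?S y *\<^sub>R (y ^ j * \<alpha> y ^ i * (\<alpha> y * \<omega> y))))) =
      indicator ?S y *\<^sub>R (Pn a b \<omega> \<alpha> n y * Pn a b \<omega> \<alpha> n (\<alpha> y + x) * \<omega> y)" for y
  proof -
    \<comment> \<open>The free factor \<open>z\<close> covers both \<open>\<omega> y\<close> and,
      after reassociation, \<open>\<alpha> y ^ i * (\<alpha> y * \<omega> y)\<close>.\<close>
    have 1: "(\<Sum>j\<le>n. c j * (indicator ?S y *\<^sub>R (y ^ j * z))) = indicator ?S y * Pn a b \<omega> \<alpha> n y * z" for z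
      by (simp add: P sum_distrib_left sum_distrib_right mult_ac)
    show ?thesis
      unfolding d mult.assoc[of "_ ^ _" "_ ^ _" "_ * _"] 1
      by (simp add: sum_distrib_left sum_distrib_right algebra_simps)
  qed
  ultimately show "set_integrable lebesgue ?S
        (\<lambda>y. Pn a b \<omega> \<alpha> n y * Pn a b \<omega> \<alpha> n (\<alpha> y + x) * \<omega> y) \<and>
      (LINT y:?S|lebesgue. Pn a b \<omega> \<alpha> n y * Pn a b \<omega> \<alpha> n (\<alpha> y + x) * \<omega> y) = Pn a b \<omega> \<alpha> n x"
    unfolding has_bochner_integral_set_iff[symmetric] by simp
qed

end
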